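(* Let $A:\mathbb{X}^\star\to\{C^0\prec\dots\prec C^{p-1}\}$ be an assignment. Suppose that the tuple of profiles $\langle b\rangle=(b^1,\dots,b^{p-1})$ in $\mathbb{X}$ is non-decreasing with respect to weak dominance (i.e. $b^1_i\le_i b^2_i\le_i\dots\le_i b^{p-1}_i$ for all $i\in\mathcal{N}$), that $\mathcal{T}$ is an upset of coalitions of criteria, and that the sorting function $\text{U-NCS}_{(\langle b\rangle,\mathcal{T})}$ extends $A$. Define a binary tuple by $$x_{i,h,k}=\begin{cases}1&\text{if }k\ge_i b^h_i\\0&\text{else}\end{cases}\qquad (i\in\mathcal{N},\ 1\le h\le p-1,\ k\in\mathbb{X}^\star_i),\qquad y_B=\begin{cases}1&\text{if }B\in\mathcal{T}\\0&\text{else}\end{cases}\qquad (B\subseteq\mathcal{N}).$$ Then this tuple is mapped to $1$ by the Boolean function $\phi^{SAT}_A$, i.e. $\phi^{SAT}_A(x,y)=1$.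
   Context: Setting. $\mathcal{N}$ is a finite set of criteria; for each $i\in\mathcal{N}$, $(\mathbb{X}_i,\le_i)$ is a totally ordered set; $\mathbb{X}=\prod_{i\in\mathcal{N}}\mathbb{X}_i$ is the set of profiles. A coalition is a subset of $\mathcal{N}$; an upset of coalitions is a family $\mathcal{T}\subseteq 2^{\mathcal{N}}$ such that $B\in\mathcal{T}$ and $B\subseteq B'\subseteq\mathcal{N}$ imply $B'\in\mathcal{T}$. For profiles $x,y$, $O_{\mathcal{N}}(x,y)=\{i\in\mathcal{N}: x_i\ge_i y_i\}$. There are $p$ ordered categories $C^0\prec C^1\prec\dots\prec C^{p-1}$; the profile (frontier) $b^h$, $1\le h\le p-1$, separates $C^{h-1}$ from $C^h$. U-NCS. For $\langle b\rangle=(b^1,\dots,b^{p-1})$ non-decreasing for weak dominance and $\mathcal{T}$ an upset of coalitions, $\text{U-NCS}_{(\langle b\rangle,\mathcal{T})}$ maps a profile $x$ to the unique category $C^k$ ($0\le k\le p-1$) such that $O_{\mathcal{N}}(x,b^k)\in\mathcal{T}$ and $O_{\mathcal{N}}(x,b^{k+1})\notin\mathcal{T}$, where by convention the first condition is regarded as always true for $k=0$ and the second as always true for $k=p-1$. Assignment. $\mathbb{X}^\star\subset\mathbb{X}$ is a finite set of reference alternatives, $\mathbb{X}^\star_i=\{x_i:x\in\mathbb{X}^\star\}$, and an assignment $A$ is a function from $\mathbb{X}^\star$ to the set of categories. A sorting function extends $A$ if it coincides with $A$ on $\mathbb{X}^\star$. SAT encoding. $\phi^{SAT}_A$ is the Boolean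 function of the variables $x_{i,h,k}$ ($i\in\mathcal{N}$, $1\le h\le p-1$, $k\in\mathbb{X}^\star_i$) and $y_B$ ($B\subseteq\mathcal{N}$) given by the conjunction of the following clauses (an empty disjunction is false): (1) for all $i\in\mathcal{N}$, $1\le h\le p-1$, $k<k'$ in $\mathbb{X}^\star_i$: $x_{i,h,k'}\vee\neg x_{i,h,k}$; (2) for all $i\in\mathcal{N}$, $1\le h<h'\le p-1$, $k\in\mathbb{X}^\star_i$: $x_{i,h,k}\vee\neg x_{i,h',k}$; (3) for all $B\subset B'\subseteq\mathcal{N}$: $y_{B'}\vee\neg y_B$; (4) for all $B\subseteq\mathcal{N}$, $1\le h\le p-1$, $u\in\mathbb{X}^\star$ with $A(u)=C^{h-1}$: $(\bigvee_{i\in B}\neg x_{i,h,u_i})\vee\neg y_B$; (5) for all $B\subseteq\mathcal{N}$, $1\le h\le p-1$, $a\in\mathbb{X}^\star$ with $A(a)=C^{h}$: $(\bigvee_{i\in B}x_{i,h,a_i})\vee y_{\mathcal{N}\setminus B}$. *)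

theory Defs
  imports Main "HOL-Library.FuncSet"
begin

text \<open>
  The possibly different value sets of the criteria are subsets \<open>X i\<close> of one type \<open>'a\<close>, and
  \<open>(u, v) \<in> le i\<close> reads \<open>u \<le>\<^sub>i v\<close>. Categories are represented by their indices
  \<open>0, \<dots>, p - 1\<close>, in their natural order; the frontiers are \<open>b 1, \<dots>, b (p - 1)\<close>, and other
  values of \<open>b\<close> are irrelevant.
\<close>

definition profiles :: "'i set \<Rightarrow> ('i \<Rightarrow> 'a set) \<Rightarrow> ('i \<Rightarrow> 'a) set" where
  "profiles N X = (\<Pi>\<^sub>E i\<in>N. X i)"

definition upset_of_coalitions :: "'i set \<Rightarrow> 'i set set \<Rightarrow> bool" where
  "upset_of_coalitions N T \<longleftrightarrow>
     T \<subseteq> Pow N \<and> (\<forall>B B'. B \<in> T \<and> B \<subseteq> B' \<and> B' \<subseteq> N \<longrightarrow> B' \<in> T)"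

definition O_set :: "'i set \<Rightarrow> ('i \<Rightarrow> 'a rel) \<Rightarrow> ('i \<Rightarrow> 'a) \<Rightarrow> ('i \<Rightarrow> 'a) \<Rightarrow> 'i set" where
  "O_set N le x y = {i \<in> N. (y i, x i) \<in> le i}"

definition weakly_dominated :: "'i set \<Rightarrow> ('i \<Rightarrow> 'a rel) \<Rightarrow> ('i \<Rightarrow> 'a) \<Rightarrow> ('i \<Rightarrow> 'a) \<Rightarrow> bool" where
  "weakly_dominated N le x y \<longleftrightarrow> (\<forall>i\<in>N. (x i, y i) \<in> le i)"

definition U_NCS ::
    "'i set \<Rightarrow> ('i \<Rightarrow> 'a rel) \<Rightarrow> nat \<Rightarrow> (nat \<Rightarrow> 'i \<Rightarrow> 'a) \<Rightarrow> 'i set set \<Rightarrow> ('i \<Rightarrow> 'a) \<Rightarrow> nat" where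
  "U_NCS N le p b T x =
     (THE k. k \<le> p - 1 \<and>
             (k = 0 \<or> O_set N le x (b k) \<in> T) \<and>
             (k = p - 1 \<or> O_set N le x (b (k + 1)) \<notin> T))"

definition ref_values :: "('i \<Rightarrow> 'a) set \<Rightarrow> 'i \<Rightarrow> 'a set" where
  "ref_values Xstar i = (\<lambda>x. x i) ` Xstar"

definition extends_assignment ::
    "(('i \<Rightarrow> 'a) \<Rightarrow> nat) \<Rightarrow> ('i \<Rightarrow> 'a) set \<Rightarrow> (('i \<Rightarrow> 'a) \<Rightarrow> nat) \<Rightarrow> bool" where
  "extends_assignment f Xstar A \<longleftrightarrow> (\<forall>x\<in>Xstar. f x = A x)"

text \<open>
  The Boolean function is total in \<open>x\<close> and \<open>y\<close>, but depends only on the variables \<open>x i h k\<close> with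
  \<open>i \<in> N\<close>, \<open>1 \<le> h \<le> p - 1\<close>, \<open>k \<in> ref_values Xstar i\<close>, and \<open>y B\<close> with \<open>B \<subseteq> N\<close>.
\<close>

definition phi_SAT ::
    "'i set \<Rightarrow> ('i \<Rightarrow> 'a rel) \<Rightarrow> nat \<Rightarrow> ('i \<Rightarrow> 'a) set \<Rightarrow> (('i \<Rightarrow> 'a) \<Rightarrow> nat) \<Rightarrow>
     ('i \<Rightarrow> nat \<Rightarrow> 'a \<Rightarrow> bool) \<Rightarrow> ('i set \<Rightarrow> bool) \<Rightarrow> bool" where
  "phi_SAT N le p Xstar A x y \<longleftrightarrow>
     (\<forall>i\<in>N. \<forall>h\<in>{1..p - 1}. \<forall>k\<in>ref_values Xstar i. \<forall>k'\<in>ref_values Xstar i.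
        (k, k') \<in> le i \<and> k \<noteq> k' \<longrightarrow> x i h k' \<or> \<not> x i h k) \<and>
     (\<forall>i\<in>N. \<forall>h\<in>{1..p - 1}. \<forall>h'\<in>{1..p - 1}. \<forall>k\<in>ref_values Xstar i.
        h < h' \<longrightarrow> x i h k \<or> \<not> x i h' k) \<and>
     (\<forall>B B'. B \<subset> B' \<and> B' \<subseteq> N \<longrightarrow> y B' \<or> \<not> y B) \<and>
     (\<forall>B\<in>Pow N. \<forall>h\<in>{1..p - 1}. \<forall>u\<in>Xstar.
        A u = h - 1 \<longrightarrow> (\<exists>i\<in>B. \<not> x i h (u i)) \<or> \<not> y B) \<and>
     (\<forall>B\<in>Pow N. \<forall>h\<in>{1..p - 1}. \<forall>a\<in>Xstar.
        A a = h \<longrightarrow> (\<exists>i\<in>B. x i h (a i)) \<or> y (N - B))"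

end

theory Submission
  imports Defs
begin

text \<open>Each clause of \<open>phi_SAT\<close> translates a property of the model. Clause (1) is
  transitivity of each \<open>le i\<close>; (2) is transitivity together with the monotone
  frontiers; (3) is the upset property. Clauses (4) and (5) use the assignment: category h-1 means
  that the coalition \<open>O_set N le u (b h)\<close> is not in \<open>T\<close>, category h means
  that it is. Since \<open>x i h (u i)\<close> says that i belongs to this coalition, the upset
  property of \<open>T\<close> gives both clauses. The real work is to extract these two facts from
  the \<open>THE\<close> in \<open>U_NCS\<close>, which needs existence and uniqueness of the
  category (\<open>ex1_threshold\<close>, \<open>U_NCS_characterization\<close>).\<close>

lemma O_set_antimono:
  assumes "\<And>i. i \<in> N \<Longrightarrow> trans (le i)" and "weakly_dominated N le y z"
  shows "O_set N le x z \<subseteq> O_set N le x y"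
  using assms unfolding O_set_def weakly_dominated_def by (blast dest: transD)

lemma upset_of_coalitionsD:
  "upset_of_coalitions N T \<Longrightarrow> B \<in> T \<Longrightarrow> B \<subseteq> B' \<Longrightarrow> B' \<subseteq> N \<Longrightarrow> B' \<in> T"
  unfolding upset_of_coalitions_def by blast

text \<open>The indices in 1..n satisfying \<open>Q\<close> form an initial segment, and k is its
  last element, or 0 if it is empty.\<close>

lemma ex1_threshold:
  fixes n :: nat
  assumes "\<And>h h'. 1 \<le> h \<Longrightarrow> h \<le> h' \<Longrightarrow> h' \<le> n \<Longrightarrow> Q h' \<Longrightarrow> Q h"
  shows "\<exists>!k. k \<le> n \<and> (k = 0 \<or> Q k) \<and> (k = n \<or> \<not> Q (k + 1))"
proof (rule ex_ex1I)
  let ?P = "\<lambda>k. k \<le> n \<and> (k = 0 \<or> Q k)"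
  define k where "k = (GREATEST k. ?P k)"
  \<comment> \<open>The maximum exists because 0 satisfies \<open>?P\<close> and n bounds
    it.\<close>
  have "?P k"
    unfolding k_def by (rule GreatestI_nat[of ?P 0 n]) auto
  moreover have "k' \<le> k" if "?P k'" for k'
    unfolding k_def by (rule Greatest_le_nat[of ?P k' n]) (use that in auto)
  ultimately show "\<exists>k. k \<le> n \<and> (k = 0 \<or> Q k) \<and> (k = n \<or> \<not> Q (k + 1))"
    by (metis Suc_eq_plus1 Suc_leI le_neq_implies_less not_less_eq_eq order_refl)
next
  fix k k'
  assume "k \<le> n \<and> (k = 0 \<or> Q k) \<and> (k = n \<or> \<not> Q (k + 1))"
    and "k' \<le> n \<and> (k' = 0 \<or> Q k') \<and> (k' = n \<or> \<not> Q (k' + 1))"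
  \<comment> \<open>If k < k', then \<open>Q k'\<close> descends to \<open>Q (k + 1)\<close>,
    contradicting the choice of k; the other case is symmetric.\<close>
  then show "k = k'"
    using assms[of "k + 1" k'] assms[of "k' + 1" k] by (cases k k' rule: linorder_cases) auto
qed

text \<open>Raising the frontier shrinks \<open>O_set\<close>, so by the upset property membership
  in \<open>T\<close> passes down to lower frontiers. Hence the threshold is unique and the
  \<open>THE\<close> satisfies its defining property.\<close>

lemma U_NCS_characterization:
  assumes "\<And>i. i \<in> N \<Longrightarrow> trans (le i)"
    and "monotone_on {1..p - 1} (\<le>) (weakly_dominated N le) b"
    and "upset_of_coalitions N T"
    and "U_NCS N le p b T u = k"
  shows "(k = 0 \<or> O_set N le u (b k) \<in> T) \<and> (k = p - 1 \<or> O_set N le u (b (k + 1)) \<notin> T)"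
proof -
  have "O_set N le u (b h) \<in> T"
    if "1 \<le> h" "h \<le> h'" "h' \<le> p - 1" "O_set N le u (b h') \<in> T" for h h'
  proof (rule upset_of_coalitionsD[OF assms(3) that(4)])
    have "weakly_dominated N le (b h) (b h')"
      using that by (intro monotone_onD[OF assms(2)]) auto
    then show "O_set N le u (b h') \<subseteq> O_set N le u (b h)"
      by (rule O_set_antimono[rotated]) (rule assms(1))
  qed (auto simp: O_set_def)
  from theI'[OF ex1_threshold[of "p - 1" "\<lambda>h. O_set N le u (b h) \<in> T", OF this]]
  show ?thesis
    using assms(4) unfolding U_NCS_def by simp
qed

theorem theorem1:
  fixes N :: "'i set"
    and X :: "'i \<Rightarrow> 'a set"
    and le :: "'i \<Rightarrow> 'a rel"
    and p :: nat
    and Xstar :: "('i \<Rightarrow> 'a) set"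
    and A :: "('i \<Rightarrow> 'a) \<Rightarrow> nat"
    and b :: "nat \<Rightarrow> 'i \<Rightarrow> 'a"
    and T :: "'i set set"
    and x :: "'i \<Rightarrow> nat \<Rightarrow> 'a \<Rightarrow> bool"
    and y :: "'i set \<Rightarrow> bool"
  assumes "finite N"
    and "\<And>i. i \<in> N \<Longrightarrow> linear_order_on (X i) (le i)"
    and "p \<ge> 1"
    and "finite Xstar" and "Xstar \<subseteq> profiles N X"
    and "A \<in> Xstar \<rightarrow> {0..<p}"
    and "b \<in> {1..p - 1} \<rightarrow> profiles N X"
    and "monotone_on {1..p - 1} (\<le>) (weakly_dominated N le) b"
    and "upset_of_coalitions N T"
    and "extends_assignment (U_NCS N le p b T) Xstar A"
    and "\<And>i h k. i \<in> N \<Longrightarrow> h \<in> {1..p - 1} \<Longrightarrow> k \<in> ref_values Xstar i \<Longrightarrow>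
           x i h k \<longleftrightarrow> (b h i, k) \<in> le i"
    and "\<And>B. B \<subseteq> N \<Longrightarrow> y B \<longleftrightarrow> B \<in> T"
  shows "phi_SAT N le p Xstar A x y"
proof -
  have trans: "trans (le i)" if "i \<in> N" for i
    using assms(2)[OF that] by (simp add: order_on_defs)
  have mono: "(b h i, b h' i) \<in> le i"
    if "i \<in> N" "h \<in> {1..p - 1}" "h' \<in> {1..p - 1}" "h < h'" for i h h'
    using monotone_onD[OF assms(8) that(2,3)] that by (simp add: weakly_dominated_def)
  have x_ref: "x i h (u i) \<longleftrightarrow> i \<in> O_set N le u (b h)"
    if "i \<in> N" "h \<in> {1..p - 1}" "u \<in> Xstar" for i h u
    using assms(11)[OF that(1,2)] that by (auto simp: O_set_def ref_values_def)
  have frontier: "(A u = 0 \<or> O_set N le u (b (A u)) \<in> T) \<and>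
      (A u = p - 1 \<or> O_set N le u (b (A u + 1)) \<notin> T)" if "u \<in> Xstar" for u
    using U_NCS_characterization[of N le p b T u, OF trans assms(8,9)] assms(10) that
    by (auto simp: extends_assignment_def)
  show ?thesis
    unfolding phi_SAT_def
  proof (intro conjI ballI allI impI)
    fix i h k k'
    assume "i \<in> N" "h \<in> {1..p - 1}" "k \<in> ref_values Xstar i" "k' \<in> ref_values Xstar i"
      and "(k, k') \<in> le i \<and> k \<noteq> k'"
    then show "x i h k' \<or> \<not> x i h k"
      using assms(11)[of i h] transD[OF trans] by metis
  next
    fix i h h' k
    assume "i \<in> N" "h \<in> {1..p - 1}" "h' \<in> {1..p - 1}" "k \<in> ref_values Xstar i" "h < h'"
    then show "x i h k \<or> \<not> x i h' k"
      using assms(11)[of i h k] assms(11)[of i h' k] transD[OF trans] mono by metis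
  next
    fix B B'
    assume "B \<subset> B' \<and> B' \<subseteq> N"
    then show "y B' \<or> \<not> y B"
      using assms(12)[of B] assms(12)[of B'] upset_of_coalitionsD[OF assms(9), of B B'] by auto
  next
    fix B h u
    assume B: "B \<in> Pow N" and h: "h \<in> {1..p - 1}" and u: "u \<in> Xstar" and "A u = h - 1"
    \<comment> \<open>As 1 \<le> h \<le> p - 1, the category h - 1 is not the top one, and its
      successor index is h.\<close>
    then have "O_set N le u (b h) \<notin> T"
      using frontier[OF u] by auto
    \<comment> \<open>The inclusion holds exactly when all the x-literals of the clause
      fail.\<close>
    then have "B \<notin> T" if "B \<subseteq> O_set N le u (b h)"
      using upset_of_coalitionsD[OF assms(9) _ that] by (auto simp: O_set_def)
    then show "(\<exists>i\<in>B. \<not> x i h (u i)) \<or> \<not> y B"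
      using assms(12)[of B] x_ref[OF _ h u] B by blast
  next
    fix B h a
    assume B: "B \<in> Pow N" and h: "h \<in> {1..p - 1}" and a: "a \<in> Xstar" and "A a = h"
    then have "O_set N le a (b h) \<in> T"
      using frontier[OF a] by auto
    \<comment> \<open>Dually, if all the x-literals fail, the coalition avoids B, so its superset
      \<open>N - B\<close> lies in \<open>T\<close>.\<close>
    then have "N - B \<in> T" if "O_set N le a (b h) \<subseteq> N - B"
      using upset_of_coalitionsD[OF assms(9) _ that] by auto
    moreover have "O_set N le a (b h) \<subseteq> N"
      by (auto simp: O_set_def)
    ultimately show "(\<exists>i\<in>B. x i h (a i)) \<or> y (N - B)"
      using assms(12)[of "N - B"] x_ref[OF _ h a] B by blast
  qed
qed

end
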